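(* Let $h\colon U\to U$ be a diffeomorphism. The symplectic map $\Psi=(\Psi^1,\Psi^2)\colon U\oplus U^\ast\to U\oplus U^\ast$ defined by $$\Psi^1(u,u^\ast)=h(u),\qquad \Psi^2(u,u^\ast)=u^\ast\circ \big(\mathrm Dh(u)\big)^{-1}$$ is an ordinary symmetry for $\phi$ if and only if $$S\circ(h\times h)=S$$ holds true up to a constant, where $(h\times h)(u,\underline u)=(h(u),h(\underline u))\in U\oplus\underline U$ denotes the diagonal action.
   Context: $U$ is a finite-dimensional real vector space, $V=U\oplus U^\ast$ carries the symplectic form $\omega((u,u^\ast),(v,v^\ast))=u^\ast(v)-v^\ast(u)$, and $\underline V=\underline U\oplus\underline U^\ast$ is a copy of $(V,\omega)$, identified with $V$ where needed. $\phi\colon V\to\underline V$ is a symplectic map with $\phi(0)=0$ that has a generating function $S\colon U\oplus\underline U\to\mathbb R$, i.e. $$\{(v,\phi(v)): v\in V\}=\{(u,\mathrm D_uS(u,\underline u),\underline u,-\mathrm D_{\underline u}S(u,\underline u)):(u,\underline u)\in U\oplus\underline U\}\subset V\oplus\underline V .$$ All maps are local (defined on neighbourhoods of $0$, shrunk if necessary; this is suppressed in the notation). A symplectic diffeomorphism $\Psi\colon V\to V$ is called an ordinary symmetry for $\phi$ if $\Psi^{-1}\circ\phi\circ\Psi=\phi$. *)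

theory Defs
  imports "HOL-Analysis.Analysis"
begin

text \<open>
  Local maps are represented by total functions together with an explicit open domain, outside of
  which their values are irrelevant; identities between local maps are identities on some
  neighbourhood of the origin. The copy of \<open>V\<close> is identified with \<open>V\<close> throughout.
\<close>

type_synonym 'a dual = "'a \<Rightarrow>\<^sub>L real"

text \<open>
  On an open subset of a finite-dimensional space, \<open>f\<close> is \<open>C\<^sup>k\<close> iff all its iterated directional
  derivatives of order less than \<open>k\<close> are differentiable and those of order \<open>k\<close> are continuous.
  Directional derivatives keep the type of \<open>f\<close>, so that the recursion is typeable. Only used for
  open \<open>X\<close> and finite-dimensional domains.
\<close>

primrec Ck_on :: "nat \<Rightarrow> ('a::real_normed_vector \<Rightarrow> 'b::real_normed_vector) \<Rightarrow> 'a set \<Rightarrow> bool" where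
  "Ck_on 0 f X \<longleftrightarrow> continuous_on X f"
| "Ck_on (Suc k) f X \<longleftrightarrow>
     (\<forall>x\<in>X. f differentiable (at x)) \<and> (\<forall>v. Ck_on k (\<lambda>x. frechet_derivative f (at x) v) X)"

definition smooth_on :: "'a::real_normed_vector set \<Rightarrow> ('a \<Rightarrow> 'b::real_normed_vector) \<Rightarrow> bool" where
  "smooth_on X f \<longleftrightarrow> (\<forall>k. Ck_on k f X)"

definition diffeo_on :: "'a::real_normed_vector set \<Rightarrow> ('a \<Rightarrow> 'b::real_normed_vector) \<Rightarrow> bool" where
  "diffeo_on X f \<longleftrightarrow> open X \<and> open (f ` X) \<and> inj_on f X \<and>
     smooth_on X f \<and> smooth_on (f ` X) (inv_into X f)"

definition omega :: "'a::euclidean_space \<times> 'a dual \<Rightarrow> 'a \<times> 'a dual \<Rightarrow> real" where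
  "omega x y = blinfun_apply (snd x) (fst y) - blinfun_apply (snd y) (fst x)"

definition symplectic_on ::
    "('a::euclidean_space \<times> 'a dual) set \<Rightarrow> ('a \<times> 'a dual \<Rightarrow> 'a \<times> 'a dual) \<Rightarrow> bool" where
  "symplectic_on X f \<longleftrightarrow> open X \<and> smooth_on X f \<and>
     (\<forall>x\<in>X. \<forall>a b. omega (frechet_derivative f (at x) a) (frechet_derivative f (at x) b) = omega a b)"

definition symplectic_diffeo_on ::
    "('a::euclidean_space \<times> 'a dual) set \<Rightarrow> ('a \<times> 'a dual \<Rightarrow> 'a \<times> 'a dual) \<Rightarrow> bool" where
  "symplectic_diffeo_on X f \<longleftrightarrow> symplectic_on X f \<and> diffeo_on X f"

definition D1 :: "('a::euclidean_space \<times> 'a \<Rightarrow> real) \<Rightarrow> 'a \<times> 'a \<Rightarrow> 'a dual" where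
  "D1 S = (\<lambda>(u, u'). Blinfun (frechet_derivative (\<lambda>x. S (x, u')) (at u)))"

definition D2 :: "('a::euclidean_space \<times> 'a \<Rightarrow> real) \<Rightarrow> 'a \<times> 'a \<Rightarrow> 'a dual" where
  "D2 S = (\<lambda>(u, u'). Blinfun (frechet_derivative (\<lambda>x. S (u, x)) (at u')))"

text \<open>\<open>S\<close>, with domain \<open>B\<close>, is a generating function for \<open>\<phi>\<close>, with domain \<open>A\<close>.\<close>

definition generating_function ::
    "('a::euclidean_space \<times> 'a) set \<Rightarrow> ('a \<times> 'a \<Rightarrow> real) \<Rightarrow>
     ('a \<times> 'a dual) set \<Rightarrow> ('a \<times> 'a dual \<Rightarrow> 'a \<times> 'a dual) \<Rightarrow> bool" where
  "generating_function B S A \<phi> \<longleftrightarrow> open B \<and> smooth_on B S \<and>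
     {(v, \<phi> v) | v. v \<in> A} = {((u, D1 S (u, u')), (u', - D2 S (u, u'))) | u u'. (u, u') \<in> B}"

text \<open>
  Here \<open>\<phi>\<close> has domain \<open>A\<close> and \<open>\<Psi>\<close> has domain \<open>X\<close>. The two membership conditions say that the
  composition is defined at \<open>v\<close>; they hold automatically near \<open>0\<close> if \<open>\<Psi>\<close> and \<open>\<phi>\<close> fix \<open>0\<close>, but
  \<open>\<Psi>\<close> is not required to do so.
\<close>

definition ordinary_symmetry ::
    "('a::euclidean_space \<times> 'a dual) set \<Rightarrow> ('a \<times> 'a dual \<Rightarrow> 'a \<times> 'a dual) \<Rightarrow>
     ('a \<times> 'a dual) set \<Rightarrow> ('a \<times> 'a dual \<Rightarrow> 'a \<times> 'a dual) \<Rightarrow> bool" where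
  "ordinary_symmetry A \<phi> X \<Psi> \<longleftrightarrow> symplectic_diffeo_on X \<Psi> \<and> 0 \<in> X \<and>
     (\<forall>\<^sub>F v in nhds 0. \<Psi> v \<in> A \<and> \<phi> (\<Psi> v) \<in> \<Psi> ` X \<and> (inv_into X \<Psi> \<circ> \<phi> \<circ> \<Psi>) v = \<phi> v)"

definition cotangent_lift :: "('a::euclidean_space \<Rightarrow> 'a) \<Rightarrow> 'a \<times> 'a dual \<Rightarrow> 'a \<times> 'a dual" where
  "cotangent_lift h = (\<lambda>(u, p). (h u, p o\<^sub>L Blinfun (inv (frechet_derivative h (at u)))))"

end

(*
  The graph of \<phi> is parametrised both by B, via (u, u') \<mapsto> (u, D1 S (u, u')), and by A, and at each
  of its points commutation of \<phi> with the cotangent lift of h says that S \<circ> (h \<times> h) and S have the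
  same differential. Both parametrisations being continuous at 0, this holds near 0 in V iff it holds
  near 0 in U \<oplus> U, and equal differentials on a ball mean equality up to a constant.
  That the lift is symplectic amounts to the symmetry of the second derivative of h.
*)

theory Submission
  imports Defs
begin

section \<open>Calculus of smooth maps\<close>

text \<open>Neither \<open>h\<close> nor its lift is assumed to fix the origin, so the domain
  conditions carry content. The pointwise equivalence therefore includes them:
  \<open>cotangent_lift h v \<in> A\<close> together with commutation at \<open>v\<close> is matched
  with \<open>(h u, h u') \<in> B\<close> together with equality of differentials at
  \<open>(u, u')\<close>. Two obstacles shape the analysis. First, \<open>Ck_on\<close> iterates
  derivatives along constant directions, whereas the chain rule produces directions that move with
  the point. Expanding in a finite basis makes them constant again, and the same expansion assembles
  an operator-valued derivative from directional ones. Second, the lift contains the inverse of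
  Dh(u). It is rewritten as the derivative of the inverse map at h(u), so that its smoothness in u
  comes from composition and not from a study of operator inversion.\<close>

lemma Ck_on_cong:
  assumes "open X" and "\<And>x. x \<in> X \<Longrightarrow> f x = g x" and "Ck_on k f X"
  shows "Ck_on k g X"
  using assms(2,3)
proof (induction k arbitrary: f g)
  case 0
  then show ?case by (metis Ck_on.simps(1) continuous_on_cong)
next
  case (Suc k)
  have d: "g differentiable (at x)" if "x \<in> X" for x
    using Suc.prems that assms(1) unfolding Ck_on.simps
    by (meson differentiable_def has_derivative_transform_within_open)
  have "Ck_on k (\<lambda>x. frechet_derivative g (at x) v) X" for v
  proof (rule Suc.IH)
    show "Ck_on k (\<lambda>x. frechet_derivative f (at x) v) X" using Suc.prems by simp
    show "frechet_derivative f (at x) v = frechet_derivative g (at x) v" if "x \<in> X" for x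
      using frechet_derivative_transform_within_open[of f x X g] Suc.prems assms(1) that by auto
  qed
  with d show ?case by simp
qed

text \<open>Uniqueness of the derivative at points of \<open>X\<close> replaces the chosen
  \<open>frechet_derivative\<close> by any explicit formula \<open>f'\<close>. This is the form in
  which all the closure rules below are proved.\<close>

lemma Ck_on_SucI:
  assumes "open X" and "\<And>x. x \<in> X \<Longrightarrow> (f has_derivative f' x) (at x)"
    and "\<And>v. Ck_on k (\<lambda>x. f' x v) X"
  shows "Ck_on (Suc k) f X"
proof -
  have "Ck_on k (\<lambda>x. frechet_derivative f (at x) v) X" for v
    by (rule Ck_on_cong[OF assms(1) _ assms(3)[of v]]) (metis assms(2) frechet_derivative_at)
  then show ?thesis using assms(2) by (auto simp: differentiable_def)
qed

lemma Ck_on_SucD: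
  assumes "Ck_on (Suc k) f X" and "x \<in> X"
  shows "(f has_derivative frechet_derivative f (at x)) (at x)"
  using assms frechet_derivative_works by auto

lemma Ck_on_Suc_imp: "Ck_on (Suc k) f X \<Longrightarrow> Ck_on k f X"
proof (induction k arbitrary: f)
  case 0
  then show ?case
    by (auto intro!: continuous_at_imp_continuous_on differentiable_imp_continuous_within)
next
  case (Suc k)
  then show ?case by (metis Ck_on.simps(2))
qed

lemma Ck_on_const: "Ck_on k (\<lambda>x. c) X"
  by (induction k arbitrary: c) auto

lemma Ck_on_ident: "open X \<Longrightarrow> Ck_on k (\<lambda>x. x) X"
proof (cases k)
  case (Suc j)
  assume "open X"
  then show ?thesis
    unfolding Suc by (rule Ck_on_SucI[OF _ has_derivative_ident Ck_on_const])
qed simp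

lemma Ck_on_bounded_linear:
  assumes "open X" and "bounded_linear L" and "Ck_on k f X"
  shows "Ck_on k (\<lambda>x. L (f x)) X"
  using assms(3)
proof (induction k arbitrary: f)
  case 0
  then show ?case using assms(2) by (auto intro: bounded_linear.continuous_on)
next
  case (Suc k)
  show ?case
  proof (rule Ck_on_SucI[OF assms(1)])
    show "((\<lambda>x. L (f x)) has_derivative (\<lambda>v. L (frechet_derivative f (at x) v))) (at x)"
      if "x \<in> X" for x
      by (rule bounded_linear.has_derivative[OF assms(2) Ck_on_SucD[OF Suc.prems that]])
    show "Ck_on k (\<lambda>x. L (frechet_derivative f (at x) v)) X" for v
      using Suc by simp
  qed
qed

lemma Ck_on_add:
  assumes "open X" and "Ck_on k f X" and "Ck_on k g X"
  shows "Ck_on k (\<lambda>x. f x + g x) X"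
  using assms(2,3)
proof (induction k arbitrary: f g)
  case 0
  then show ?case by (auto intro: continuous_on_add)
next
  case (Suc k)
  show ?case
  proof (rule Ck_on_SucI[OF assms(1)])
    show "((\<lambda>x. f x + g x) has_derivative
        (\<lambda>v. frechet_derivative f (at x) v + frechet_derivative g (at x) v)) (at x)"
      if "x \<in> X" for x
      using Suc.prems[THEN Ck_on_SucD, OF that] by (rule has_derivative_add)
    show "Ck_on k (\<lambda>x. frechet_derivative f (at x) v + frechet_derivative g (at x) v) X" for v
      using Suc by simp
  qed
qed

lemma Ck_on_sum:
  assumes "open X" and "\<And>i. i \<in> I \<Longrightarrow> Ck_on k (f i) X"
  shows "Ck_on k (\<lambda>x. \<Sum>i\<in>I. f i x) X"
  using assms(2)
proof (induction I rule: infinite_finite_induct)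
  case (insert i I)
  have "Ck_on k (\<lambda>x. f i x + (\<Sum>i\<in>I. f i x)) X"
    using insert by (intro Ck_on_add[OF assms(1)]) blast+
  then show ?case using insert.hyps by simp
qed (auto intro: Ck_on_const)

lemma Ck_on_Pair:
  assumes "open X" and "Ck_on k f X" and "Ck_on k g X"
  shows "Ck_on k (\<lambda>x. (f x, g x)) X"
proof -
  have "Ck_on k (\<lambda>x. (f x, 0) + (0, g x)) X"
    using assms by (intro Ck_on_add Ck_on_bounded_linear[of X "\<lambda>x. (x, 0)"]
        Ck_on_bounded_linear[of X "\<lambda>x. (0, x)"] bounded_linear_Pair) (auto intro: bounded_linear_intros)
  then show ?thesis by simp
qed

lemma (in bounded_bilinear) Ck_on:
  assumes "open X" and "Ck_on k f X" and "Ck_on k g X"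
  shows "Ck_on k (\<lambda>x. prod (f x) (g x)) X"
  using assms(2,3)
proof (induction k arbitrary: f g)
  case 0
  then show ?case by (auto intro: continuous_on)
next
  case (Suc k)
  show ?case
  proof (rule Ck_on_SucI[OF assms(1)])
    show "((\<lambda>x. prod (f x) (g x)) has_derivative
        (\<lambda>v. prod (f x) (frechet_derivative g (at x) v) + prod (frechet_derivative f (at x) v) (g x))) (at x)"
      if "x \<in> X" for x
      using Suc.prems[THEN Ck_on_SucD, OF that] by (rule FDERIV)
    show "Ck_on k (\<lambda>x. prod (f x) (frechet_derivative g (at x) v) + prod (frechet_derivative f (at x) v) (g x)) X"
      for v
      using Suc.prems Ck_on_Suc_imp[OF Suc.prems(1)] Ck_on_Suc_imp[OF Suc.prems(2)]
      by (intro Ck_on_add[OF assms(1)] Suc.IH) auto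
  qed
qed

text \<open>The derivative along \<open>v\<close> is the derivative of \<open>f\<close> along the
  constant direction \<open>L v\<close>, again composed with \<open>L\<close>, so the induction
  hypothesis applies without a basis expansion.\<close>

lemma Ck_on_compose_bounded_linear:
  assumes "open X" and "bounded_linear L" and "Ck_on k f X"
  shows "Ck_on k (\<lambda>x. f (L x)) (L -` X)"
  using assms(3)
proof (induction k arbitrary: f)
  case 0
  then show ?case
    using continuous_on_compose2[OF _ linear_continuous_on[OF assms(2)], of X f "L -` X"] by auto
next
  case (Suc k)
  have "open (L -` X)"
    using assms(1,2) by (intro open_vimage) (auto intro: linear_continuous_on)
  then show ?case
  proof (rule Ck_on_SucI)
    show "((\<lambda>x. f (L x)) has_derivative (\<lambda>v. frechet_derivative f (at (L x)) (L v))) (at x)"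
      if "x \<in> L -` X" for x
      using that
      by (intro has_derivative_compose[OF bounded_linear_imp_has_derivative[OF assms(2)]]
          Ck_on_SucD[OF Suc.prems]) simp
    show "Ck_on k (\<lambda>x. frechet_derivative f (at (L x)) (L v)) (L -` X)" for v
      using Suc.IH[of "\<lambda>x. frechet_derivative f (at x) (L v)"] Suc.prems by simp
  qed
qed

section \<open>Composition of \<open>Ck_on\<close> maps\<close>

lemma linear_basis_expansion:
  fixes L :: "'a::euclidean_space \<Rightarrow> 'b::real_vector"
  assumes "linear L"
  shows "L w = (\<Sum>i\<in>Basis. (w \<bullet> i) *\<^sub>R L i)"
proof -
  have "L w = L (\<Sum>i\<in>Basis. (w \<bullet> i) *\<^sub>R i)" by (simp add: euclidean_representation)
  then show ?thesis by (simp add: linear_sum[OF assms] linear_scale[OF assms])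
qed

text \<open>In the chain rule the direction \<open>?G x v\<close> varies with \<open>x\<close>.
  Expanding it in \<open>Basis\<close> leaves scalar coefficients times derivatives of
  \<open>f\<close> along fixed basis vectors, to which the product rule and the induction hypothesis
  apply.\<close>

lemma Ck_on_compose:
  fixes f :: "'b::euclidean_space \<Rightarrow> 'c::real_normed_vector" and g :: "'a::real_normed_vector \<Rightarrow> 'b"
  assumes "open X" and "open Y" and "g ` X \<subseteq> Y" and "Ck_on k f Y" and "Ck_on k g X"
  shows "Ck_on k (\<lambda>x. f (g x)) X"
  using assms(4,5)
proof (induction k arbitrary: f)
  case 0
  then show ?case using assms(3) by (auto intro: continuous_on_compose2)
next
  case (Suc k)
  let ?F = "\<lambda>x i. frechet_derivative f (at (g x)) i"
  let ?G = "\<lambda>x. frechet_derivative g (at x)"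
  show ?case
  proof (rule Ck_on_SucI[OF assms(1)])
    fix x assume x: "x \<in> X"
    then have gx: "g x \<in> Y" using assms(3) by auto
    have f': "(f has_derivative ?F x) (at (g x))" by (rule Ck_on_SucD[OF Suc.prems(1) gx])
    have "((\<lambda>x. f (g x)) has_derivative (\<lambda>v. ?F x (?G x v))) (at x)"
      by (rule has_derivative_compose[OF Ck_on_SucD[OF Suc.prems(2) x] f'])
    then show "((\<lambda>x. f (g x)) has_derivative (\<lambda>v. \<Sum>i\<in>Basis. (?G x v \<bullet> i) *\<^sub>R ?F x i)) (at x)"
      by (simp flip: linear_basis_expansion[OF has_derivative_linear[OF f']])
  next
    fix v
    show "Ck_on k (\<lambda>x. \<Sum>i\<in>Basis. (?G x v \<bullet> i) *\<^sub>R ?F x i) X"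
    proof (intro Ck_on_sum[OF assms(1)] bounded_bilinear.Ck_on[OF bounded_bilinear_scaleR] assms(1))
      fix i :: 'b
      show "Ck_on k (\<lambda>x. ?F x i) X"
        using Suc.prems Ck_on_Suc_imp[OF Suc.prems(2)] by (intro Suc.IH) auto
      show "Ck_on k (\<lambda>x. ?G x v \<bullet> i) X"
        using Suc.prems by (intro Ck_on_bounded_linear[OF assms(1) bounded_linear_inner_left]) auto
    qed
  qed
qed

section \<open>Smooth maps and their operator-valued derivatives\<close>

lemma smooth_on_has_derivative:
  assumes "smooth_on X f" and "x \<in> X"
  shows "(f has_derivative frechet_derivative f (at x)) (at x)"
proof (rule Ck_on_SucD[OF _ assms(2)])
  show "Ck_on (Suc 0) f X" using assms(1) unfolding smooth_on_def ..
qed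

lemma smooth_on_continuous_on: "smooth_on X f \<Longrightarrow> continuous_on X f"
  unfolding smooth_on_def using Ck_on.simps(1) by blast

lemma smooth_on_frechet_derivative:
  assumes "smooth_on X f"
  shows "smooth_on X (\<lambda>x. frechet_derivative f (at x) v)"
  unfolding smooth_on_def
proof (intro allI)
  show "Ck_on k (\<lambda>x. frechet_derivative f (at x) v) X" for k
    using assms[unfolded smooth_on_def, rule_format, of "Suc k"] by simp
qed

lemma smooth_on_Blinfun_frechet_derivative:
  fixes f :: "'a::euclidean_space \<Rightarrow> 'b::real_normed_vector"
  assumes "open X" and "smooth_on X f"
  shows "smooth_on X (\<lambda>x. Blinfun (frechet_derivative f (at x)))"
  unfolding smooth_on_def
proof
  fix k
  \<comment> \<open>\<open>?E i w\<close> is the rank one operator sending \<open>y\<close> to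
    \<open>(y \<bullet> i) *\<^sub>R w\<close>. It is linear in \<open>w\<close>, so the derivative
    becomes a finite sum of bounded linear images of directional derivatives.\<close>
  let ?E = "\<lambda>i w. blinfun_scaleR_left w o\<^sub>L blinfun_inner_left i"
  have bl: "bounded_linear (?E i :: 'b \<Rightarrow> 'a \<Rightarrow>\<^sub>L 'b)" for i
    by (intro bounded_linear_compose[OF
        bounded_bilinear.bounded_linear_left[OF bounded_bilinear_blinfun_compose]]
        bounded_linear_blinfun_scaleR_left)
  have "Ck_on k (\<lambda>x. \<Sum>i\<in>Basis. ?E i (frechet_derivative f (at x) i)) X"
    using smooth_on_frechet_derivative[OF assms(2)] unfolding smooth_on_def
    by (intro Ck_on_sum assms(1) Ck_on_bounded_linear[OF _ bl]) auto
  then show "Ck_on k (\<lambda>x. Blinfun (frechet_derivative f (at x))) X"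
  proof (rule Ck_on_cong[OF assms(1), rotated])
    fix x assume x: "x \<in> X"
    show "(\<Sum>i\<in>Basis. ?E i (frechet_derivative f (at x) i))
      = Blinfun (frechet_derivative f (at x))"
    proof (rule blinfun_eqI)
      fix w
      have d: "(f has_derivative frechet_derivative f (at x)) (at x)"
        using smooth_on_has_derivative[OF assms(2) x] .
      show "blinfun_apply (\<Sum>i\<in>Basis. ?E i (frechet_derivative f (at x) i)) w
        = blinfun_apply (Blinfun (frechet_derivative f (at x))) w"
        using linear_basis_expansion[OF has_derivative_linear[OF d], of w]
        by (simp add: bounded_linear_Blinfun_apply[OF has_derivative_bounded_linear[OF d]]
            blinfun.sum_left inner_commute)
    qed
  qed
qed

section \<open>Symmetry of second derivatives\<close>

text \<open>The mean value theorem is used twice: along \<open>a\<close> for the difference of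
  \<open>f\<close> on two parallel segments, then along \<open>b\<close> for the directional
  derivative of \<open>f\<close> along \<open>a\<close>. The left-hand side is symmetric in
  \<open>a\<close> and \<open>b\<close>, which is what makes it useful.\<close>

lemma second_difference_mean_value:
  fixes f :: "'a::real_normed_vector \<Rightarrow> real"
  assumes "Ck_on 2 f X" and "t > 0"
    and X: "\<And>s r. \<lbrakk>0 \<le> s; s \<le> t; 0 \<le> r; r \<le> t\<rbrakk> \<Longrightarrow> x + s *\<^sub>R a + r *\<^sub>R b \<in> X"
  shows "\<exists>s r. 0 < s \<and> s < t \<and> 0 < r \<and> r < t \<and>
    f (x + t *\<^sub>R a + t *\<^sub>R b) - f (x + t *\<^sub>R a) - f (x + t *\<^sub>R b) + f x =
    t\<^sup>2 * frechet_derivative (\<lambda>y. frechet_derivative f (at y) a) (at (x + s *\<^sub>R a + r *\<^sub>R b)) b"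
proof -
  let ?Df = "\<lambda>y. frechet_derivative f (at y)"
  let ?D2 = "\<lambda>y. frechet_derivative (\<lambda>y. ?Df y a) (at y)"
  have C: "Ck_on (Suc (Suc 0)) f X" using assms(1) by (simp add: numeral_2_eq_2)
  have Df: "(f has_derivative ?Df y) (at y)" if "y \<in> X" for y
    using Ck_on_SucD[OF C that] .
  have D2: "((\<lambda>y. ?Df y a) has_derivative ?D2 y) (at y)" if "y \<in> X" for y
    using C that by (intro Ck_on_SucD[where k=0 and X=X]) auto
  have along: "((\<lambda>s. F (y + s *\<^sub>R v)) has_real_derivative F' v) (at s)"
    if "(F has_derivative F') (at (y + s *\<^sub>R v))" for F :: "'a \<Rightarrow> real" and F' y v s
  proof -
    have "((\<lambda>s. F (y + s *\<^sub>R v)) has_derivative (\<lambda>w. F' (w *\<^sub>R v))) (at s)"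
      by (rule has_derivative_compose[where g=F and g'=F' and f="\<lambda>s. y + s *\<^sub>R v"
            and f'="\<lambda>w. w *\<^sub>R v"]) (use that in \<open>auto intro!: derivative_eq_intros\<close>)
    then show ?thesis
      using linear_scale[OF has_derivative_linear[OF that]]
      by (simp add: has_field_derivative_def mult.commute[of _ "F' v"])
  qed
  have "\<exists>s>0. s < t \<and> (f (x + t *\<^sub>R b + t *\<^sub>R a) - f (x + t *\<^sub>R a))
      - (f (x + t *\<^sub>R b + 0 *\<^sub>R a) - f (x + 0 *\<^sub>R a))
      = (t - 0) * (?Df (x + t *\<^sub>R b + s *\<^sub>R a) a - ?Df (x + s *\<^sub>R a) a)"
  proof (rule MVT2[OF \<open>t > 0\<close>])
    fix s assume s: "0 \<le> s" "s \<le> t"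
    have "x + t *\<^sub>R b + s *\<^sub>R a \<in> X" "x + s *\<^sub>R a \<in> X"
      using X[of s t] X[of s 0] s by (auto simp: algebra_simps)
    then show "((\<lambda>s. f (x + t *\<^sub>R b + s *\<^sub>R a) - f (x + s *\<^sub>R a)) has_real_derivative
        (?Df (x + t *\<^sub>R b + s *\<^sub>R a) a - ?Df (x + s *\<^sub>R a) a)) (at s)"
      by (intro DERIV_diff along Df)
  qed
  then obtain s where s: "0 < s" "s < t" and 1: "f (x + t *\<^sub>R b + t *\<^sub>R a) - f (x + t *\<^sub>R a)
      - (f (x + t *\<^sub>R b) - f x) = t * (?Df (x + t *\<^sub>R b + s *\<^sub>R a) a - ?Df (x + s *\<^sub>R a) a)"
    by auto
  have "\<exists>r>0. r < t \<and> ?Df (x + s *\<^sub>R a + t *\<^sub>R b) a - ?Df (x + s *\<^sub>R a + 0 *\<^sub>R b) a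
      = (t - 0) * ?D2 (x + s *\<^sub>R a + r *\<^sub>R b) b"
    using s by (intro MVT2[OF \<open>t > 0\<close>] along[where F="\<lambda>y. ?Df y a"] D2 X) auto
  then obtain r where r: "0 < r" "r < t"
    and 2: "?Df (x + s *\<^sub>R a + t *\<^sub>R b) a - ?Df (x + s *\<^sub>R a) a = t * ?D2 (x + s *\<^sub>R a + r *\<^sub>R b) b"
    by auto
  have "f (x + t *\<^sub>R a + t *\<^sub>R b) - f (x + t *\<^sub>R a) - f (x + t *\<^sub>R b) + f x
      = t\<^sup>2 * ?D2 (x + s *\<^sub>R a + r *\<^sub>R b) b"
    using 1 2 by (simp add: algebra_simps power2_eq_square)
  then show ?thesis using s r by blast
qed

text \<open>Evaluating one second difference in both orders makes the two mixed derivatives agree,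
  though at two different points near \<open>x\<close>. Continuity then forces agreement at
  \<open>x\<close>.\<close>

lemma symmetric_second_derivative_real:
  fixes f :: "'a::real_normed_vector \<Rightarrow> real"
  assumes "open X" and C: "Ck_on 2 f X" and "x \<in> X"
  shows "frechet_derivative (\<lambda>y. frechet_derivative f (at y) a) (at x) b =
    frechet_derivative (\<lambda>y. frechet_derivative f (at y) b) (at x) a"
proof (rule ccontr)
  let ?P = "\<lambda>y. frechet_derivative (\<lambda>y. frechet_derivative f (at y) a) (at y) b"
  let ?Q = "\<lambda>y. frechet_derivative (\<lambda>y. frechet_derivative f (at y) b) (at y) a"
  assume "?P x \<noteq> ?Q x"
  \<comment> \<open>Half the gap: a common value within \<open>e\<close> of both \<open>?P x\<close>
    and \<open>?Q x\<close> would put them at distance less than \<open>2 * e\<close>, which is the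
    gap itself.\<close>
  define e where "e = \<bar>?P x - ?Q x\<bar> / 2"
  have e: "e > 0" using \<open>?P x \<noteq> ?Q x\<close> by (simp add: e_def)
  have "continuous_on X ?P" "continuous_on X ?Q"
    using C by (auto simp: numeral_2_eq_2)
  then have "isCont ?P x" "isCont ?Q x"
    using assms by (auto simp: continuous_on_eq_continuous_at)
  then have "(?P \<longlongrightarrow> ?P x) (nhds x)" "(?Q \<longlongrightarrow> ?Q x) (nhds x)"
    unfolding isCont_def
    using tendsto_at_iff_tendsto_nhds[of ?P x] tendsto_at_iff_tendsto_nhds[of ?Q x] by auto
  then have "\<forall>\<^sub>F y in nhds x. dist (?P y) (?P x) < e" "\<forall>\<^sub>F y in nhds x. dist (?Q y) (?Q x) < e"
    using e by (auto dest: tendstoD)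
  then have "\<forall>\<^sub>F y in nhds x. dist (?P y) (?P x) < e \<and> dist (?Q y) (?Q x) < e \<and> y \<in> X"
    by (intro eventually_conj eventually_nhds_in_open assms)
  then obtain d where d: "d > 0"
    and near: "\<And>y. dist y x < d \<Longrightarrow> dist (?P y) (?P x) < e \<and> dist (?Q y) (?Q x) < e \<and> y \<in> X"
    unfolding eventually_nhds_metric by blast
  \<comment> \<open>Small enough for the whole parallelogram with sides \<open>t *\<^sub>R a\<close>
    and \<open>t *\<^sub>R b\<close> to lie in the ball of radius \<open>d\<close>. The summand 1
    keeps the denominator positive and the estimate strict.\<close>
  define t where "t = d / (norm a + norm b + 1)"
  have t: "t > 0" using d unfolding t_def by (auto intro!: divide_pos_pos add_nonneg_pos)
  have sm: "dist (x + s *\<^sub>R a + r *\<^sub>R b) x < d" if "0 \<le> s" "s \<le> t" "0 \<le> r" "r \<le> t" for s r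
  proof -
    have "dist (x + s *\<^sub>R a + r *\<^sub>R b) x \<le> norm (s *\<^sub>R a) + norm (r *\<^sub>R b)"
      by (simp add: dist_norm add.assoc) (metis norm_scaleR norm_triangle_ineq)
    also have "\<dots> \<le> t * norm a + t * norm b"
      using that by (auto intro!: add_mono mult_right_mono)
    also have "\<dots> < t * (norm a + norm b + 1)" using t by (simp add: algebra_simps)
    also have "\<dots> = d"
      unfolding t_def using add_nonneg_pos[of "norm a + norm b" 1] by simp
    finally show ?thesis .
  qed
  obtain s r where sr: "0 < s" "s < t" "0 < r" "r < t"
    and P: "f (x + t *\<^sub>R a + t *\<^sub>R b) - f (x + t *\<^sub>R a) - f (x + t *\<^sub>R b) + f x
      = t\<^sup>2 * ?P (x + s *\<^sub>R a + r *\<^sub>R b)"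
    using second_difference_mean_value[OF C t, of x a b] near sm by blast
  have sm': "x + s *\<^sub>R b + r *\<^sub>R a \<in> X" if "0 \<le> s" "s \<le> t" "0 \<le> r" "r \<le> t" for s r
    using near[OF sm[of r s]] that by (simp add: algebra_simps)
  obtain s' r' where sr': "0 < s'" "s' < t" "0 < r'" "r' < t"
    and Q: "f (x + t *\<^sub>R b + t *\<^sub>R a) - f (x + t *\<^sub>R b) - f (x + t *\<^sub>R a) + f x
      = t\<^sup>2 * ?Q (x + s' *\<^sub>R b + r' *\<^sub>R a)"
    using second_difference_mean_value[OF C t, of x b a] sm' by blast
  have "t\<^sup>2 * ?P (x + s *\<^sub>R a + r *\<^sub>R b) = t\<^sup>2 * ?Q (x + r' *\<^sub>R a + s' *\<^sub>R b)"
    using P Q by (simp add: algebra_simps)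
  then have eq: "?P (x + s *\<^sub>R a + r *\<^sub>R b) = ?Q (x + r' *\<^sub>R a + s' *\<^sub>R b)" using t by simp
  have "dist (?P (x + s *\<^sub>R a + r *\<^sub>R b)) (?P x) < e" "dist (?Q (x + r' *\<^sub>R a + s' *\<^sub>R b)) (?Q x) < e"
    using near sm[of s r] sm[of r' s'] sr sr' by auto
  then show False unfolding eq dist_real_def e_def by (auto simp: abs_if split: if_splits)
qed

text \<open>Reduction to the scalar case, since taking the component along \<open>i\<close> commutes
  with both differentiations. For the outer one this uses that \<open>X\<close> is open, because the
  inner derivatives are compared only on \<open>X\<close>.\<close>

lemma symmetric_second_derivative:
  fixes f :: "'a::real_normed_vector \<Rightarrow> 'b::euclidean_space"
  assumes "open X" and C: "Ck_on 2 f X" and "x \<in> X"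
  shows "frechet_derivative (\<lambda>y. frechet_derivative f (at y) a) (at x) b =
    frechet_derivative (\<lambda>y. frechet_derivative f (at y) b) (at x) a"
proof (rule euclidean_eqI)
  fix i :: 'b
  have D: "frechet_derivative (\<lambda>z. F z \<bullet> i) (at y) v = frechet_derivative F (at y) v \<bullet> i"
    if "F differentiable (at y)" for F :: "'a \<Rightarrow> 'b" and y v
    using frechet_derivative_at[OF bounded_linear.has_derivative[OF bounded_linear_inner_left
        that[unfolded frechet_derivative_works]], of i] by metis
  have df: "f differentiable (at y)" "(\<lambda>y. frechet_derivative f (at y) v) differentiable (at y)"
    if "y \<in> X" for y v
    using C that by (auto simp: numeral_2_eq_2)
  have D2: "frechet_derivative (\<lambda>y. frechet_derivative (\<lambda>z. f z \<bullet> i) (at y) v) (at x) w =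
    frechet_derivative (\<lambda>y. frechet_derivative f (at y) v) (at x) w \<bullet> i" for v w
  proof -
    have "(\<lambda>y. frechet_derivative f (at y) v \<bullet> i) differentiable (at x)"
      using bounded_linear.has_derivative[OF bounded_linear_inner_left
          df(2)[OF assms(3), unfolded frechet_derivative_works]]
      unfolding differentiable_def by blast
    then have "frechet_derivative (\<lambda>y. frechet_derivative f (at y) v \<bullet> i) (at x) =
      frechet_derivative (\<lambda>y. frechet_derivative (\<lambda>z. f z \<bullet> i) (at y) v) (at x)"
      by (rule frechet_derivative_transform_within_open[OF _ assms(1,3)]) (simp add: D df(1))
    then show ?thesis by (simp flip: D[OF df(2)[OF assms(3)]])
  qed
  have "Ck_on 2 (\<lambda>z. f z \<bullet> i) X"
    by (rule Ck_on_bounded_linear[OF assms(1) bounded_linear_inner_left C])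
  from symmetric_second_derivative_real[OF assms(1) this assms(3), of a b]
  show "frechet_derivative (\<lambda>y. frechet_derivative f (at y) a) (at x) b \<bullet> i =
    frechet_derivative (\<lambda>y. frechet_derivative f (at y) b) (at x) a \<bullet> i"
    unfolding D2 .
qed

section \<open>Cotangent lifts\<close>

lemma diffeo_on_inv_into:
  assumes "diffeo_on X f"
  shows "diffeo_on (f ` X) (inv_into X f)"
proof -
  have inj: "inj_on f X" and X: "open X" and f: "smooth_on X f"
    using assms unfolding diffeo_on_def by auto
  have im: "inv_into X f ` f ` X = X"
    using inj by (simp add: inv_into_image_cancel)
  have "inv_into (f ` X) (inv_into X f) x = f x" if "x \<in> X" for x
    using that inj by (intro inv_into_f_eq inj_on_inv_into) auto
  then have "smooth_on X (inv_into (f ` X) (inv_into X f))"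
    using f Ck_on_cong[OF X, of f "inv_into (f ` X) (inv_into X f)"] unfolding smooth_on_def by simp
  then show ?thesis
    using assms im by (auto simp: diffeo_on_def inj_on_inv_into)
qed

text \<open>The chain rule for the two composites, which are the identity near \<open>x\<close> and
  near \<open>f x\<close>. Both identities are needed to recognise the function inverse
  \<open>inv\<close> that occurs in \<open>cotangent_lift\<close>.\<close>

lemma diffeo_on_derivative_inverse:
  assumes "diffeo_on X f" and x: "x \<in> X"
  shows "frechet_derivative (inv_into X f) (at (f x)) (frechet_derivative f (at x) v) = v"
    and "frechet_derivative f (at x) (frechet_derivative (inv_into X f) (at (f x)) w) = w"
proof -
  let ?g = "inv_into X f"
  have inj: "inj_on f X" and X: "open X" "open (f ` X)"
    and sm: "smooth_on X f" "smooth_on (f ` X) ?g"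
    using assms unfolding diffeo_on_def by auto
  have f: "(f has_derivative frechet_derivative f (at x)) (at x)"
    and g: "(?g has_derivative frechet_derivative ?g (at (f x))) (at (f x))"
    using smooth_on_has_derivative[OF sm(1) x] smooth_on_has_derivative[OF sm(2) imageI[OF x]] .
  have gfx: "?g (f x) = x" using inj x by simp
  have "((\<lambda>y. ?g (f y)) has_derivative
      (\<lambda>v. frechet_derivative ?g (at (f x)) (frechet_derivative f (at x) v))) (at x)"
    by (rule has_derivative_compose[OF f g])
  then have "((\<lambda>y. y) has_derivative
      (\<lambda>v. frechet_derivative ?g (at (f x)) (frechet_derivative f (at x) v))) (at x)"
    by (rule has_derivative_transform_within_open[OF _ X(1) x]) (simp add: inj)
  from has_derivative_unique[OF this has_derivative_ident]
  show "frechet_derivative ?g (at (f x)) (frechet_derivative f (at x) v) = v" by meson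
  have "((\<lambda>y. f (?g y)) has_derivative
      (\<lambda>w. frechet_derivative f (at x) (frechet_derivative ?g (at (f x)) w))) (at (f x))"
    by (rule has_derivative_compose[OF g]) (simp add: gfx f)
  then have "((\<lambda>y. y) has_derivative
      (\<lambda>w. frechet_derivative f (at x) (frechet_derivative ?g (at (f x)) w))) (at (f x))"
    by (rule has_derivative_transform_within_open[OF _ X(2)]) (use x in \<open>auto simp: f_inv_into_f\<close>)
  from has_derivative_unique[OF this has_derivative_ident]
  show "frechet_derivative f (at x) (frechet_derivative ?g (at (f x)) w) = w" by meson
qed

text \<open>The inverse operator becomes the derivative of the inverse map at \<open>h u\<close>,
  whose dependence on \<open>u\<close> is visibly smooth.\<close>

lemma cotangent_lift_eq:
  assumes "diffeo_on D h" and "u \<in> D"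
  shows "cotangent_lift h (u, p) =
    (h u, p o\<^sub>L Blinfun (frechet_derivative (inv_into D h) (at (h u))))"
proof -
  have "inv (frechet_derivative h (at u)) = frechet_derivative (inv_into D h) (at (h u))"
    using diffeo_on_derivative_inverse[OF assms] by (intro inv_unique_comp) auto
  then show ?thesis by (simp add: cotangent_lift_def)
qed

lemma cotangent_lift_inv_into_eq:
  assumes "diffeo_on D h" and "u \<in> D"
  shows "cotangent_lift (inv_into D h) (h u, q) = (u, q o\<^sub>L Blinfun (frechet_derivative h (at u)))"
proof -
  have "inv (frechet_derivative (inv_into D h) (at (h u))) = frechet_derivative h (at u)"
    using diffeo_on_derivative_inverse[OF assms] by (intro inv_unique_comp) auto
  then show ?thesis using assms by (simp add: cotangent_lift_def diffeo_on_def)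
qed

lemma diffeo_on_Blinfun_apply:
  assumes "diffeo_on X f" and "x \<in> X"
  shows "blinfun_apply (Blinfun (frechet_derivative f (at x))) = frechet_derivative f (at x)"
proof (intro bounded_linear_Blinfun_apply has_derivative_bounded_linear[where F="at x"])
  have "smooth_on X f" using assms(1) unfolding diffeo_on_def by simp
  then show "(f has_derivative frechet_derivative f (at x)) (at x)"
    using assms(2) by (rule smooth_on_has_derivative)
qed

lemma diffeo_on_Blinfun_compose:
  assumes "diffeo_on X f" and "x \<in> X"
  shows "Blinfun (frechet_derivative (inv_into X f) (at (f x))) o\<^sub>L
      Blinfun (frechet_derivative f (at x)) = id_blinfun"
    and "Blinfun (frechet_derivative f (at x)) o\<^sub>L
      Blinfun (frechet_derivative (inv_into X f) (at (f x))) = id_blinfun"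
proof -
  note L = diffeo_on_Blinfun_apply[OF assms]
    diffeo_on_Blinfun_apply[OF diffeo_on_inv_into[OF assms(1)] imageI[OF assms(2)]]
  show "Blinfun (frechet_derivative (inv_into X f) (at (f x))) o\<^sub>L
      Blinfun (frechet_derivative f (at x)) = id_blinfun"
    by (rule blinfun_eqI) (simp add: L diffeo_on_derivative_inverse(1)[OF assms])
  show "Blinfun (frechet_derivative f (at x)) o\<^sub>L
      Blinfun (frechet_derivative (inv_into X f) (at (f x))) = id_blinfun"
    by (rule blinfun_eqI) (simp add: L diffeo_on_derivative_inverse(2)[OF assms])
qed

section \<open>Composition of operators, and the inverse of the lift\<close>

lemma blinfun_compose_id [simp]: "f o\<^sub>L id_blinfun = f"
  by (rule blinfun_eqI) simp

lemma blinfun_compose_assoc: "(f o\<^sub>L g) o\<^sub>L k = f o\<^sub>L (g o\<^sub>L k)"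
  by (rule blinfun_eqI) simp

text \<open>Lifting is functorial, so the inverse of the lift is itself a lift. Smoothness of the
  inverse then needs no separate argument.\<close>

lemma cotangent_lift_inv_into:
  assumes "diffeo_on D h" and "x \<in> D \<times> UNIV"
  shows "cotangent_lift (inv_into D h) (cotangent_lift h x) = x"
proof -
  obtain u p where "u \<in> D" "x = (u, p)" using assms(2) by auto
  then show ?thesis
    by (simp add: cotangent_lift_eq[OF assms(1)] cotangent_lift_inv_into_eq[OF assms(1)]
        blinfun_compose_assoc diffeo_on_Blinfun_compose[OF assms(1)])
qed

lemma cotangent_lift_of_inv_into:
  assumes "diffeo_on D h" and "y \<in> h ` D \<times> UNIV"
  shows "cotangent_lift h (cotangent_lift (inv_into D h) y) = y"
proof -
  obtain u q where "u \<in> D" "y = (h u, q)" using assms(2) by auto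
  then show ?thesis
    by (simp add: cotangent_lift_eq[OF assms(1)] cotangent_lift_inv_into_eq[OF assms(1)]
        blinfun_compose_assoc diffeo_on_Blinfun_compose[OF assms(1)])
qed

lemma inj_on_cotangent_lift: "diffeo_on D h \<Longrightarrow> inj_on (cotangent_lift h) (D \<times> UNIV)"
  by (rule inj_on_inverseI[where g="cotangent_lift (inv_into D h)"]) (rule cotangent_lift_inv_into)

lemma image_cotangent_lift:
  assumes "diffeo_on D h"
  shows "cotangent_lift h ` (D \<times> UNIV) = h ` D \<times> UNIV"
proof
  show "cotangent_lift h ` (D \<times> UNIV) \<subseteq> h ` D \<times> UNIV"
    by (auto simp: cotangent_lift_def)
  show "h ` D \<times> UNIV \<subseteq> cotangent_lift h ` (D \<times> UNIV)"
  proof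
    fix y :: "'a \<times> 'a dual" assume y: "y \<in> h ` D \<times> UNIV"
    then have "cotangent_lift (inv_into D h) y \<in> D \<times> UNIV"
      using assms by (auto simp: cotangent_lift_inv_into_eq)
    then show "y \<in> cotangent_lift h ` (D \<times> UNIV)"
      using cotangent_lift_of_inv_into[OF assms y] by (metis image_eqI)
  qed
qed

lemma smooth_on_inverse_derivative:
  fixes h :: "'a::euclidean_space \<Rightarrow> 'a"
  assumes "diffeo_on D h"
  shows "smooth_on D (\<lambda>u. Blinfun (frechet_derivative (inv_into D h) (at (h u))))"
  unfolding smooth_on_def
proof
  fix k
  have *: "open D" "open (h ` D)" "smooth_on D h"
    using assms unfolding diffeo_on_def by auto
  have "smooth_on (h ` D) (\<lambda>w. Blinfun (frechet_derivative (inv_into D h) (at w)))"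
    using assms unfolding diffeo_on_def by (intro smooth_on_Blinfun_frechet_derivative) auto
  then have "Ck_on k (\<lambda>w. Blinfun (frechet_derivative (inv_into D h) (at w))) (h ` D)"
    and "Ck_on k h D"
    using * unfolding smooth_on_def by auto
  then show "Ck_on k (\<lambda>u. Blinfun (frechet_derivative (inv_into D h) (at (h u)))) D"
    by (rule Ck_on_compose[OF *(1,2) order_refl])
qed

lemma smooth_on_cotangent_lift:
  fixes h :: "'a::euclidean_space \<Rightarrow> 'a"
  assumes "diffeo_on D h"
  shows "smooth_on (D \<times> UNIV) (cotangent_lift h)"
  unfolding smooth_on_def
proof
  fix k
  let ?M = "\<lambda>u. Blinfun (frechet_derivative (inv_into D h) (at (h u)))"
  have D: "open D" and h: "Ck_on k h D" using assms unfolding diffeo_on_def smooth_on_def by auto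
  have M: "Ck_on k ?M D" using smooth_on_inverse_derivative[OF assms] unfolding smooth_on_def by simp
  have D': "open (D \<times> (UNIV :: 'a dual set))" using D by (simp add: open_Times)
  have vim: "fst -` D = D \<times> (UNIV :: 'a dual set)" by auto
  have "Ck_on k (\<lambda>x. h (fst x)) (D \<times> (UNIV :: 'a dual set))"
    and "Ck_on k (\<lambda>x. ?M (fst x)) (D \<times> (UNIV :: 'a dual set))"
    unfolding vim[symmetric]
    by (rule Ck_on_compose_bounded_linear[OF D bounded_linear_fst h],
        rule Ck_on_compose_bounded_linear[OF D bounded_linear_fst M])
  then have "Ck_on k (\<lambda>x. (h (fst x), snd x o\<^sub>L ?M (fst x))) (D \<times> (UNIV :: 'a dual set))"
    by (intro Ck_on_Pair D' bounded_bilinear.Ck_on[OF bounded_bilinear_blinfun_compose]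
        Ck_on_bounded_linear[OF _ bounded_linear_snd] Ck_on_ident)
  then show "Ck_on k (cotangent_lift h) (D \<times> UNIV)"
    by (rule Ck_on_cong[OF D', rotated]) (auto simp: cotangent_lift_eq[OF assms])
qed

lemma has_derivative_cotangent_lift:
  fixes h :: "'a::euclidean_space \<Rightarrow> 'a" and D :: "'a set"
  defines "M \<equiv> \<lambda>u. Blinfun (frechet_derivative (inv_into D h) (at (h u)))"
  assumes "diffeo_on D h" and u: "u \<in> D"
  shows "(cotangent_lift h has_derivative (\<lambda>y. (frechet_derivative h (at u) (fst y),
    (p o\<^sub>L frechet_derivative M (at u) (fst y)) + (snd y o\<^sub>L M u)))) (at (u, p))"
proof -
  have D: "open D" and h: "smooth_on D h" using assms(2) unfolding diffeo_on_def by auto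
  have D': "open (D \<times> (UNIV :: 'a dual set))" using D by (simp add: open_Times)
  have M: "smooth_on D M" using smooth_on_inverse_derivative[OF assms(2)] unfolding M_def .
  have Dh: "(h has_derivative frechet_derivative h (at u)) (at (fst (u, p)))"
    and DM: "(M has_derivative frechet_derivative M (at u)) (at (fst (u, p)))"
    using smooth_on_has_derivative[OF h u] smooth_on_has_derivative[OF M u] by simp_all
  have 1: "((\<lambda>y. h (fst y)) has_derivative (\<lambda>y. frechet_derivative h (at u) (fst y))) (at (u, p))"
    by (rule has_derivative_compose[OF has_derivative_fst[OF has_derivative_ident] Dh])
  have 2: "((\<lambda>y. M (fst y)) has_derivative (\<lambda>y. frechet_derivative M (at u) (fst y)))
      (at (u, p))"
    by (rule has_derivative_compose[OF has_derivative_fst[OF has_derivative_ident] DM])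
  have "((\<lambda>y. (h (fst y), snd y o\<^sub>L M (fst y))) has_derivative
      (\<lambda>y. (frechet_derivative h (at u) (fst y),
        (snd (u, p) o\<^sub>L frechet_derivative M (at u) (fst y)) + (snd y o\<^sub>L M (fst (u, p))))))
      (at (u, p))"
    by (intro has_derivative_Pair 1 bounded_bilinear.FDERIV[OF bounded_bilinear_blinfun_compose]
        has_derivative_snd has_derivative_ident 2)
  then show ?thesis
    unfolding fst_conv snd_conv
    by (rule has_derivative_transform_within_open[OF _ D'])
      (use u in \<open>auto simp: cotangent_lift_eq[OF assms(2)] M_def\<close>)
qed

text \<open>Differentiate the identity \<open>M u (frechet_derivative h (at u) b) = b\<close>, valid
  on the open set \<open>D\<close>, along \<open>a\<close>. The product rule yields two terms with
  sum zero.\<close>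

lemma derivative_of_inverse_derivative:
  fixes h :: "'a::euclidean_space \<Rightarrow> 'a" and D :: "'a set"
  defines "M \<equiv> \<lambda>u. Blinfun (frechet_derivative (inv_into D h) (at (h u)))"
  assumes "diffeo_on D h" and u: "u \<in> D"
  shows "frechet_derivative M (at u) a (frechet_derivative h (at u) b) =
    - blinfun_apply (M u) (frechet_derivative (\<lambda>u. frechet_derivative h (at u) b) (at u) a)"
proof -
  let ?F = "\<lambda>u. frechet_derivative h (at u) b"
  have D: "open D" and h: "smooth_on D h" using assms(2) unfolding diffeo_on_def by auto
  have M: "smooth_on D M" using smooth_on_inverse_derivative[OF assms(2)] unfolding M_def .
  have "((\<lambda>u. M u (?F u)) has_derivative (\<lambda>a. M u (frechet_derivative ?F (at u) a)
      + frechet_derivative M (at u) a (?F u))) (at u)"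
    by (intro bounded_bilinear.FDERIV[OF bounded_bilinear_blinfun_apply]
        smooth_on_has_derivative[OF M u] smooth_on_has_derivative[OF _ u]
        smooth_on_frechet_derivative[OF h])
  moreover have "M u (?F u) = b" if "u \<in> D" for u
    using diffeo_on_derivative_inverse(1)[OF assms(2) that]
      diffeo_on_Blinfun_apply[OF diffeo_on_inv_into[OF assms(2)]] that by (simp add: M_def)
  ultimately have "((\<lambda>u. b) has_derivative (\<lambda>a. M u (frechet_derivative ?F (at u) a)
      + frechet_derivative M (at u) a (?F u))) (at u)"
    by (rule has_derivative_transform_within_open[OF _ D u])
  from has_derivative_unique[OF this has_derivative_const]
  have "M u (frechet_derivative ?F (at u) a) + frechet_derivative M (at u) a (?F u) = 0"
    by meson
  then show ?thesis by (simp add: eq_neg_iff_add_eq_0 add.commute)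
qed

lemma symplectic_diffeo_on_cotangent_lift:
  fixes h :: "'a::euclidean_space \<Rightarrow> 'a"
  assumes "diffeo_on D h"
  shows "symplectic_diffeo_on (D \<times> UNIV) (cotangent_lift h)"
proof -
  let ?X = "D \<times> (UNIV :: 'a dual set)" and ?\<Psi> = "cotangent_lift h"
  have D: "open D" "open (h ` D)" and h: "smooth_on D h" using assms unfolding diffeo_on_def by auto
  have X: "open ?X" "open (h ` D \<times> (UNIV :: 'a dual set))" using D by (auto intro: open_Times)
  have "inv_into ?X ?\<Psi> y = cotangent_lift (inv_into D h) y"
    if y: "y \<in> h ` D \<times> UNIV" for y
  proof (rule inv_into_f_eq[OF inj_on_cotangent_lift[OF assms]])
    show "cotangent_lift (inv_into D h) y \<in> ?X"
      using y assms by (auto simp: cotangent_lift_inv_into_eq)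
    show "?\<Psi> (cotangent_lift (inv_into D h) y) = y" by (rule cotangent_lift_of_inv_into[OF assms y])
  qed
  then have "smooth_on (?\<Psi> ` ?X) (inv_into ?X ?\<Psi>)"
    using smooth_on_cotangent_lift[OF diffeo_on_inv_into[OF assms]] Ck_on_cong[OF X(2)]
    unfolding smooth_on_def image_cotangent_lift[OF assms] by metis
  then have "diffeo_on ?X ?\<Psi>"
    unfolding diffeo_on_def using X inj_on_cotangent_lift[OF assms] smooth_on_cotangent_lift[OF assms]
    by (simp add: image_cotangent_lift[OF assms])
  moreover have "omega (frechet_derivative ?\<Psi> (at x) y) (frechet_derivative ?\<Psi> (at x) z) = omega y z"
    if x: "x \<in> ?X" for x y z
  proof -
    obtain u p where up: "x = (u, p)" "u \<in> D" using x by auto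
    let ?M = "\<lambda>u. Blinfun (frechet_derivative (inv_into D h) (at (h u)))"
    let ?D2 = "\<lambda>a b. frechet_derivative (\<lambda>u. frechet_derivative h (at u) b) (at u) a"
    have sym: "?D2 a b = ?D2 b a" for a b
      using symmetric_second_derivative[OF D(1) _ up(2), of h] h unfolding smooth_on_def by blast
    have M: "?M u (frechet_derivative h (at u) a) = a" for a
      using diffeo_on_derivative_inverse(1)[OF assms up(2)]
        diffeo_on_Blinfun_apply[OF diffeo_on_inv_into[OF assms]] up(2) by simp
    show ?thesis
      \<comment> \<open>In \<open>omega\<close> the terms linear in the covector parts of
        \<open>y\<close> and \<open>z\<close> reduce to \<open>omega y z\<close> by
        \<open>M\<close>. The remaining ones are \<open>p\<close> applied to \<open>?M u\<close> of
        the second derivative of \<open>h\<close>, and they cancel in the antisymmetric difference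
        by \<open>sym\<close>.\<close>
      unfolding up(1) frechet_derivative_at[OF has_derivative_cotangent_lift[OF assms up(2)], symmetric]
      using sym[of "fst y" "fst z"]
      by (simp add: omega_def blinfun.add_left derivative_of_inverse_derivative[OF assms up(2)]
          blinfun.minus_right M)
  qed
  ultimately show ?thesis
    unfolding symplectic_diffeo_on_def symplectic_on_def
    using X smooth_on_cotangent_lift[OF assms] by blast
qed

section \<open>Generating functions\<close>

text \<open>The partial derivatives are the total derivative restricted to the two factors. The
  second claim writes this restriction as an operator composition, from which continuity of
  \<open>D1 S\<close> follows.\<close>

lemma has_derivative_D1_D2:
  assumes "smooth_on B S" and "z \<in> B"
  shows "(S has_derivative (\<lambda>y. D1 S z (fst y) + D2 S z (snd y))) (at z)"
    and "D1 S z = Blinfun (frechet_derivative S (at z)) o\<^sub>L Blinfun (\<lambda>a. (a, 0))"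
proof -
  obtain u u' where z: "z = (u, u')" by fastforce
  let ?S' = "frechet_derivative S (at z)"
  have S: "(S has_derivative ?S') (at z)" by (rule smooth_on_has_derivative[OF assms])
  have 1: "((\<lambda>x. S (x, u')) has_derivative (\<lambda>a. ?S' (a, 0))) (at u)"
    by (rule has_derivative_compose[of "\<lambda>x. (x, u')" "\<lambda>a. (a, 0)"])
      (use S in \<open>auto simp: z intro!: derivative_eq_intros\<close>)
  have 2: "((\<lambda>x. S (u, x)) has_derivative (\<lambda>b. ?S' (0, b))) (at u')"
    by (rule has_derivative_compose[of "\<lambda>x. (u, x)" "\<lambda>b. (0, b)"])
      (use S in \<open>auto simp: z intro!: derivative_eq_intros\<close>)
  have D1: "blinfun_apply (D1 S z) = (\<lambda>a. ?S' (a, 0))"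
    using frechet_derivative_at[OF 1] has_derivative_bounded_linear[OF 1]
    by (simp add: z D1_def bounded_linear_Blinfun_apply)
  have D2: "blinfun_apply (D2 S z) = (\<lambda>b. ?S' (0, b))"
    using frechet_derivative_at[OF 2] has_derivative_bounded_linear[OF 2]
    by (simp add: z D2_def bounded_linear_Blinfun_apply)
  have "?S' y = D1 S z (fst y) + D2 S z (snd y)" for y
    using linear_add[OF has_derivative_linear[OF S], of "(fst y, 0)" "(0, snd y)"]
    by (simp add: D1 D2)
  then have "?S' = (\<lambda>y. D1 S z (fst y) + D2 S z (snd y))" by (rule ext)
  then show "(S has_derivative (\<lambda>y. D1 S z (fst y) + D2 S z (snd y))) (at z)" using S by simp
  have "bounded_linear (\<lambda>a::'a. (a, 0::'a))"
    by (intro bounded_linear_Pair bounded_linear_ident bounded_linear_zero)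
  then show "D1 S z = Blinfun ?S' o\<^sub>L Blinfun (\<lambda>a. (a, 0))"
    by (intro blinfun_eqI)
      (simp add: D1 bounded_linear_Blinfun_apply has_derivative_bounded_linear[OF S])
qed

lemma continuous_on_D1:
  assumes "open B" and "smooth_on B S"
  shows "continuous_on B (D1 S)"
proof -
  have "continuous_on B (\<lambda>z. Blinfun (frechet_derivative S (at z)) o\<^sub>L Blinfun (\<lambda>a. (a, 0)))"
    using smooth_on_continuous_on[OF smooth_on_Blinfun_frechet_derivative[OF assms]]
    by (intro continuous_intros)
  then show ?thesis
    using has_derivative_D1_D2(2)[OF assms(2)] by (simp cong: continuous_on_cong)
qed

section \<open>Commutation with the lift in terms of \<open>S\<close>\<close>

lemma has_derivative_comp_map_prod:
  assumes "smooth_on B S" and "diffeo_on D h" and "u \<in> D" and "u' \<in> D" and "(h u, h u') \<in> B"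
  shows "((S \<circ> map_prod h h) has_derivative
    (\<lambda>y. D1 S (h u, h u') (frechet_derivative h (at u) (fst y))
      + D2 S (h u, h u') (frechet_derivative h (at u') (snd y)))) (at (u, u'))"
proof -
  have h: "(h has_derivative frechet_derivative h (at x)) (at x)" if "x \<in> D" for x
    using assms(2) smooth_on_has_derivative[OF _ that] unfolding diffeo_on_def by blast
  have 1: "((\<lambda>y. h (fst y)) has_derivative (\<lambda>y. frechet_derivative h (at u) (fst y))) (at (u, u'))"
    by (rule has_derivative_compose[OF has_derivative_fst[OF has_derivative_ident]])
      (simp add: h assms(3))
  have 2: "((\<lambda>y. h (snd y)) has_derivative (\<lambda>y. frechet_derivative h (at u') (snd y))) (at (u, u'))"
    by (rule has_derivative_compose[OF has_derivative_snd[OF has_derivative_ident]])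
      (simp add: h assms(4))
  have S: "(S has_derivative (\<lambda>y. D1 S (h u, h u') (fst y) + D2 S (h u, h u') (snd y)))
      (at (h (fst (u, u')), h (snd (u, u'))))"
    using has_derivative_D1_D2(1)[OF assms(1,5)] by simp
  have "((\<lambda>y. S (h (fst y), h (snd y))) has_derivative
    (\<lambda>y. D1 S (h u, h u') (frechet_derivative h (at u) (fst y))
      + D2 S (h u, h u') (frechet_derivative h (at u') (snd y)))) (at (u, u'))"
    using has_derivative_compose[OF has_derivative_Pair[OF 1 2] S] by simp
  then show ?thesis by (simp add: comp_def map_prod_def case_prod_beta)
qed

lemma generating_functionD:
  assumes "generating_function B S A \<phi>" and "(u, u') \<in> B"
  shows "(u, D1 S (u, u')) \<in> A" and "\<phi> (u, D1 S (u, u')) = (u', - D2 S (u, u'))"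
proof -
  have "((u, D1 S (u, u')), (u', - D2 S (u, u'))) \<in> {(v, \<phi> v) | v. v \<in> A}"
    using assms unfolding generating_function_def by blast
  then show "(u, D1 S (u, u')) \<in> A" and "\<phi> (u, D1 S (u, u')) = (u', - D2 S (u, u'))" by auto
qed

text \<open>The pair is determined by \<open>v\<close>: it can only be
  \<open>(fst v, fst (\<phi> v))\<close>. This provides the inverse of the parametrisation by
  \<open>B\<close>.\<close>

lemma generating_functionE:
  assumes "generating_function B S A \<phi>" and "v \<in> A"
  obtains u u' where "(u, u') \<in> B" and "v = (u, D1 S (u, u'))" and "\<phi> v = (u', - D2 S (u, u'))"
proof -
  have "(v, \<phi> v) \<in> {((u, D1 S (u, u')), (u', - D2 S (u, u'))) | u u'. (u, u') \<in> B}"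
    using assms unfolding generating_function_def by blast
  then show thesis using that by blast
qed

text \<open>The left side says that the lifted pair of \<open>v\<close> and \<open>\<phi> v\<close>
  lies on the graph of \<open>\<phi>\<close>. Its base points are \<open>h u\<close> and
  \<open>h u'\<close>, so only the two covectors remain to be compared, and after transposition
  these equations are the chain rule for \<open>S \<circ> map_prod h h\<close>.\<close>

lemma cotangent_lift_commute_iff:
  assumes gen: "generating_function B S A \<phi>" and h: "diffeo_on D h"
    and B: "(u, u') \<in> B" and u: "u \<in> D" and u': "u' \<in> D"
  defines "v \<equiv> (u, D1 S (u, u'))"
  shows "cotangent_lift h v \<in> A \<and> \<phi> (cotangent_lift h v) = cotangent_lift h (\<phi> v) \<longleftrightarrow>
    (h u, h u') \<in> B \<and> ((S \<circ> map_prod h h) has_derivative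
      (\<lambda>y. D1 S (u, u') (fst y) + D2 S (u, u') (snd y))) (at (u, u'))"
proof -
  have S: "smooth_on B S" using gen unfolding generating_function_def by auto
  let ?M = "\<lambda>u. Blinfun (frechet_derivative (inv_into D h) (at (h u)))"
  let ?L = "\<lambda>u. Blinfun (frechet_derivative h (at u))"
  have \<phi>v: "\<phi> v = (u', - D2 S (u, u'))"
    unfolding v_def by (rule generating_functionD[OF gen B])
  have \<Psi>v: "cotangent_lift h v = (h u, D1 S (u, u') o\<^sub>L ?M u)"
    unfolding v_def by (rule cotangent_lift_eq[OF h u])
  have \<Psi>\<phi>v: "cotangent_lift h (\<phi> v) = (h u', (- D2 S (u, u')) o\<^sub>L ?M u')"
    unfolding \<phi>v by (rule cotangent_lift_eq[OF h u'])
  \<comment> \<open>\<open>?M x\<close> and \<open>?L x\<close> are mutually inverse, so the inverse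
    derivative moves to the other side as the derivative of \<open>h\<close>.\<close>
  have transpose: "p o\<^sub>L ?M x = q \<longleftrightarrow> p = q o\<^sub>L ?L x" if "x \<in> D" for x and p q :: "'a dual"
    by (auto simp: blinfun_compose_assoc diffeo_on_Blinfun_compose[OF h that])
  have minus: "(- p) o\<^sub>L k = - q \<longleftrightarrow> p o\<^sub>L k = q" for p q :: "'a dual" and k :: "'a \<Rightarrow>\<^sub>L 'a"
    by (simp add: bounded_bilinear.minus_left[OF bounded_bilinear_blinfun_compose])
  have "cotangent_lift h v \<in> A \<and> \<phi> (cotangent_lift h v) = cotangent_lift h (\<phi> v) \<longleftrightarrow>
    (h u, h u') \<in> B \<and> D1 S (u, u') o\<^sub>L ?M u = D1 S (h u, h u')
      \<and> (- D2 S (u, u')) o\<^sub>L ?M u' = - D2 S (h u, h u')"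
  proof
    assume *: "cotangent_lift h v \<in> A \<and> \<phi> (cotangent_lift h v) = cotangent_lift h (\<phi> v)"
    \<comment> \<open>Comparing first components forces \<open>w = h u\<close> and
      \<open>w' = h u'\<close>.\<close>
    then obtain w w' where "(w, w') \<in> B" "cotangent_lift h v = (w, D1 S (w, w'))"
      "\<phi> (cotangent_lift h v) = (w', - D2 S (w, w'))"
      using generating_functionE[OF gen] by metis
    then show "(h u, h u') \<in> B \<and> D1 S (u, u') o\<^sub>L ?M u = D1 S (h u, h u')
      \<and> (- D2 S (u, u')) o\<^sub>L ?M u' = - D2 S (h u, h u')"
      using * unfolding \<Psi>v \<Psi>\<phi>v by auto
  next
    assume "(h u, h u') \<in> B \<and> D1 S (u, u') o\<^sub>L ?M u = D1 S (h u, h u')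
      \<and> (- D2 S (u, u')) o\<^sub>L ?M u' = - D2 S (h u, h u')"
    then show "cotangent_lift h v \<in> A \<and> \<phi> (cotangent_lift h v) = cotangent_lift h (\<phi> v)"
      using generating_functionD[OF gen, of "h u" "h u'"] unfolding \<Psi>v \<Psi>\<phi>v by auto
  qed
  also have "\<dots> \<longleftrightarrow> (h u, h u') \<in> B \<and> D1 S (u, u') = D1 S (h u, h u') o\<^sub>L ?L u
      \<and> D2 S (u, u') = D2 S (h u, h u') o\<^sub>L ?L u'"
    by (simp only: minus transpose u u')
  also have "\<dots> \<longleftrightarrow> (h u, h u') \<in> B \<and> ((S \<circ> map_prod h h) has_derivative
      (\<lambda>y. D1 S (u, u') (fst y) + D2 S (u, u') (snd y))) (at (u, u'))" (is "_ \<and> ?eq \<longleftrightarrow> _ \<and> ?der")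
  proof (rule conj_cong[OF refl])
    assume "(h u, h u') \<in> B"
    note S' = has_derivative_comp_map_prod[OF S h u u' this]
    note L = diffeo_on_Blinfun_apply[OF h]
    show "?eq \<longleftrightarrow> ?der"
    proof
      assume ?eq
      then show ?der using S' by (simp add: L u u')
    next
      assume ?der
      from has_derivative_unique[OF this S']
      have eq: "D1 S (u, u') (fst y) + D2 S (u, u') (snd y) =
          D1 S (h u, h u') (frechet_derivative h (at u) (fst y))
          + D2 S (h u, h u') (frechet_derivative h (at u') (snd y))" for y
        by meson
      \<comment> \<open>Testing \<open>eq\<close> on vectors \<open>(a, 0)\<close> and
        \<open>(0, b)\<close> separates the two covector equations, because the derivatives of
        \<open>h\<close> vanish at the zero vector.\<close>
      have "linear (frechet_derivative h (at x))" if "x \<in> D" for x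
        using L[OF that] by (metis blinfun.bounded_linear_right bounded_linear.linear)
      then have "frechet_derivative h (at u) 0 = 0" "frechet_derivative h (at u') 0 = 0"
        using u u' by (auto intro: linear_0)
      then show ?eq
        using eq[of "(_, 0)"] eq[of "(0, _)"]
        by (auto intro!: blinfun_eqI simp: L u u' blinfun.zero_right)
    qed
  qed
  finally show ?thesis .
qed

section \<open>The equivalence near the origin\<close>

theorem proposition3p7:
  fixes \<phi> :: "'a::euclidean_space \<times> 'a dual \<Rightarrow> 'a \<times> 'a dual"
    and A :: "('a \<times> 'a dual) set"
    and S :: "'a \<times> 'a \<Rightarrow> real"
    and B :: "('a \<times> 'a) set"
    and h :: "'a \<Rightarrow> 'a"
    and D :: "'a set"
  assumes "symplectic_on A \<phi>" and "0 \<in> A" and "\<phi> 0 = 0"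
    and "generating_function B S A \<phi>"
    and "diffeo_on D h" and "0 \<in> D"
  shows "ordinary_symmetry A \<phi> (D \<times> UNIV) (cotangent_lift h) \<longleftrightarrow>
    (\<exists>c. \<forall>\<^sub>F x in nhds 0. map_prod h h x \<in> B \<and> (S \<circ> map_prod h h) x = S x + c)"
proof -
  note gen = assms(4) and h = assms(5)
  let ?X = "D \<times> (UNIV :: 'a dual set)" and ?\<Psi> = "cotangent_lift h" and ?H = "map_prod h h"
  let ?dS = "\<lambda>z y. D1 S z (fst y) + D2 S z (snd y)"
  \<comment> \<open>The parametrisation of \<open>A\<close> by \<open>B\<close>. On \<open>B\<close>
    the second component of \<open>z\<close> is recovered as
    \<open>fst (\<phi> (G z))\<close>.\<close>
  define G where "G z = (fst z, D1 S z)" for z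
  have A: "open A" "smooth_on A \<phi>" using assms(1) unfolding symplectic_on_def by auto
  have B: "open B" "smooth_on B S" using gen unfolding generating_function_def by auto
  have D: "open D" using h unfolding diffeo_on_def by simp
  \<comment> \<open>The graph contains the point over \<open>0 \<in> A\<close>. Since
    \<open>\<phi> 0 = 0\<close>, both of its base points are zero, and its first covector
    \<open>D1 S 0\<close> vanishes.\<close>
  have "0 \<in> B" and G0: "G 0 = 0"
  proof -
    obtain u u' where "(u, u') \<in> B" "0 = (u, D1 S (u, u'))" "\<phi> 0 = (u', - D2 S (u, u'))"
      by (rule generating_functionE[OF gen assms(2)])
    then show "0 \<in> B" and "G 0 = 0"
      using assms(3) by (auto simp: zero_prod_def G_def)
  qed
  have "continuous_on B G"
    unfolding G_def by (intro continuous_intros continuous_on_D1[OF B])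
  then have "isCont G 0" using B(1) \<open>0 \<in> B\<close> by (simp add: continuous_on_eq_continuous_at)
  then have G_lim: "filterlim G (nhds 0) (nhds 0)"
    using tendsto_at_iff_tendsto_nhds[of G 0] by (simp add: isCont_def G0)
  have "isCont \<phi> 0"
    using smooth_on_continuous_on[OF A(2)] A(1) assms(2) by (simp add: continuous_on_eq_continuous_at)
  then have \<phi>_lim: "filterlim \<phi> (nhds 0) (nhds 0)"
    using tendsto_at_iff_tendsto_nhds[of \<phi> 0] by (simp add: isCont_def assms(3))
  have BD: "\<forall>\<^sub>F z in nhds 0. z \<in> B \<inter> D \<times> D"
    using B(1) D \<open>0 \<in> B\<close> assms(6)
    by (intro eventually_nhds_in_open open_Int open_Times) (auto simp: zero_prod_def)
  have key: "?\<Psi> (G z) \<in> A \<and> \<phi> (?\<Psi> (G z)) = ?\<Psi> (\<phi> (G z)) \<longleftrightarrow>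
      ?H z \<in> B \<and> ((S \<circ> ?H) has_derivative ?dS z) (at z)" if "z \<in> B \<inter> D \<times> D" for z
    using cotangent_lift_commute_iff[OF gen h, of "fst z" "snd z"] that by (cases z) (simp add: G_def)
  have inX: "\<phi> (G z) \<in> ?X" if "z \<in> B \<inter> D \<times> D" for z
    using generating_functionD[OF gen, of "fst z" "snd z"] that by (cases z) (simp add: G_def)
  show ?thesis
  proof
    assume "ordinary_symmetry A \<phi> ?X ?\<Psi>"
    then have "\<forall>\<^sub>F v in nhds 0. ?\<Psi> v \<in> A \<and> \<phi> (?\<Psi> v) \<in> ?\<Psi> ` ?X
        \<and> (inv_into ?X ?\<Psi> \<circ> \<phi> \<circ> ?\<Psi>) v = \<phi> v"
      unfolding ordinary_symmetry_def by blast
    \<comment> \<open>Applying \<open>?\<Psi>\<close> to both sides removes \<open>inv_into\<close>,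
      which is legitimate because \<open>\<phi> (?\<Psi> v)\<close> is known to lie in the image of
      \<open>?\<Psi>\<close>.\<close>
    then have "\<forall>\<^sub>F v in nhds 0. ?\<Psi> v \<in> A \<and> \<phi> (?\<Psi> v) = ?\<Psi> (\<phi> v)"
      by (rule eventually_mono) (metis comp_apply f_inv_into_f)
    then have "\<forall>\<^sub>F z in nhds 0. ?\<Psi> (G z) \<in> A \<and> \<phi> (?\<Psi> (G z)) = ?\<Psi> (\<phi> (G z))"
      using G_lim by (rule eventually_compose_filterlim)
    with BD have "\<forall>\<^sub>F z in nhds 0. z \<in> B \<and> ?H z \<in> B \<and> ((S \<circ> ?H) has_derivative ?dS z) (at z)"
      by eventually_elim (use key in blast)
    then obtain e where e: "e > 0" and near:
      "\<And>z. z \<in> ball 0 e \<Longrightarrow> z \<in> B \<and> ?H z \<in> B \<and> ((S \<circ> ?H) has_derivative ?dS z) (at z)"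
      unfolding eventually_nhds_metric by (auto simp: dist_commute)
    have "((\<lambda>z. (S \<circ> ?H) z - S z) has_derivative (\<lambda>y. 0)) (at z within ball 0 e)"
      if "z \<in> ball 0 e" for z
    proof -
      have "((\<lambda>z. (S \<circ> ?H) z - S z) has_derivative (\<lambda>y. ?dS z y - ?dS z y)) (at z)"
        by (rule has_derivative_diff[OF conjunct2[OF conjunct2[OF near[OF that]]]
              has_derivative_D1_D2(1)[OF B(2) conjunct1[OF near[OF that]]]])
      then show ?thesis by (simp add: has_derivative_at_withinI)
    qed
    then obtain c where c: "\<forall>z\<in>ball 0 e. (S \<circ> ?H) z - S z = c"
      using has_derivative_zero_constant[OF convex_ball] by blast
    have "\<forall>\<^sub>F z in nhds 0. z \<in> ball 0 e"
      using e by (intro eventually_nhds_in_open) auto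
    then have "\<forall>\<^sub>F z in nhds 0. ?H z \<in> B \<and> (S \<circ> ?H) z = S z + c"
      by (rule eventually_mono) (use near c in \<open>force simp: algebra_simps\<close>)
    then show "\<exists>c. \<forall>\<^sub>F z in nhds 0. ?H z \<in> B \<and> (S \<circ> ?H) z = S z + c" ..
  next
    assume "\<exists>c. \<forall>\<^sub>F z in nhds 0. ?H z \<in> B \<and> (S \<circ> ?H) z = S z + c"
    then obtain c W where W: "open W" "0 \<in> W"
      and inv: "\<And>z. z \<in> W \<Longrightarrow> ?H z \<in> B \<and> (S \<circ> ?H) z = S z + c"
      unfolding eventually_nhds by auto
    have comm: "?\<Psi> (G z) \<in> A \<and> \<phi> (?\<Psi> (G z)) = ?\<Psi> (\<phi> (G z))"
      if z: "z \<in> W" "z \<in> B \<inter> D \<times> D" for z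
    proof -
      \<comment> \<open>The constant disappears on differentiation, and \<open>W\<close> is open, so
        equality of values on \<open>W\<close> gives equality of differentials there.\<close>
      have "((\<lambda>z. S z + c) has_derivative ?dS z) (at z)"
        using has_derivative_add[OF has_derivative_D1_D2(1)[OF B(2)] has_derivative_const, of z c] z
        by simp
      then have "((S \<circ> ?H) has_derivative ?dS z) (at z)"
        by (rule has_derivative_transform_within_open[OF _ W(1) z(1)]) (use inv in auto)
      then show ?thesis using key[OF z(2)] inv[OF z(1)] by blast
    qed
    \<comment> \<open>The inverse of \<open>G\<close>: the base points of \<open>v\<close> and of
      its image. It tends to 0 at 0 because \<open>\<phi>\<close> does, so neighbourhoods of the
      origin in the base pull back to neighbourhoods in phase space.\<close>
    let ?Z = "\<lambda>v. (fst v, fst (\<phi> v))"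
    have fst_lim: "filterlim fst (nhds (0::'a)) (nhds (0 :: 'a \<times> 'a dual))"
      using tendsto_fst[OF filterlim_ident, of "0 :: 'a \<times> 'a dual"] by simp
    have "filterlim ?Z (nhds 0) (nhds 0)"
      using tendsto_Pair[OF fst_lim filterlim_compose[OF fst_lim \<phi>_lim]] by (simp add: zero_prod_def)
    moreover have "\<forall>\<^sub>F z in nhds 0. z \<in> W \<and> z \<in> B \<inter> D \<times> D"
      by (rule eventually_conj[OF eventually_nhds_in_open[OF W] BD])
    ultimately have "\<forall>\<^sub>F v in nhds 0. ?Z v \<in> W \<and> ?Z v \<in> B \<inter> D \<times> D"
      by (rule eventually_compose_filterlim[rotated])
    moreover have "\<forall>\<^sub>F v in nhds 0. v \<in> A"
      using A(1) assms(2) by (rule eventually_nhds_in_open)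
    ultimately have "\<forall>\<^sub>F v in nhds 0. ?\<Psi> v \<in> A \<and> \<phi> (?\<Psi> v) \<in> ?\<Psi> ` ?X
        \<and> (inv_into ?X ?\<Psi> \<circ> \<phi> \<circ> ?\<Psi>) v = \<phi> v"
    proof eventually_elim
      case (elim v)
      have v: "v = G (?Z v)"
        by (rule generating_functionE[OF gen elim(2)]) (simp add: G_def)
      have "?\<Psi> v \<in> A" "\<phi> (?\<Psi> v) = ?\<Psi> (\<phi> v)"
        using comm[of "?Z v"] elim(1) unfolding v[symmetric] by auto
      \<comment> \<open>Cancelling \<open>inv_into ?X ?\<Psi>\<close> against \<open>?\<Psi>\<close>
        requires the argument \<open>\<phi> v\<close> to lie in the domain of injectivity. Its base
        point is the second component of \<open>?Z v\<close>, which is in \<open>D\<close>.\<close>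
      moreover have "\<phi> v \<in> ?X"
        using inX[of "?Z v"] elim(1) unfolding v[symmetric] by auto
      ultimately show ?case
        using inj_on_cotangent_lift[OF h] by simp
    qed
    then show "ordinary_symmetry A \<phi> ?X ?\<Psi>"
      unfolding ordinary_symmetry_def
      using symplectic_diffeo_on_cotangent_lift[OF h] assms(6) by (simp add: zero_prod_def)
  qed
qed

end
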